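(* Suppose that the following assumptions hold for the data center system described in the context: (A1) $Q_j^F \ge A_{j,\max} + \sum_{i\in\Omega_j^F} M_{ij}$ for all $j$; (A2) $Q_i^B \ge E_i + \sum_{j\in\Omega_i^B} M_{ij}$ for all $i$; (A3) $\overline{B}_i-\underline{B}_i \ge \eta_{\mathrm c} C_i + \frac{1}{\eta_{\mathrm d}} D_i$ for all $i$; (A4) $P^{\mathrm b}_{\max}\,\eta_{\mathrm c}\eta_{\mathrm d} < P^{\mathrm s}_{\min} + \beta_i(1+\eta_{\mathrm c}\eta_{\mathrm d})$ for all $i$. Suppose that the parameters $V>0$ and $r_i$ (together with the parameters $\theta_j,\varphi_i,\delta_i$) satisfy $$V \ge \max_j \max_{i\in\Omega_j^F} \frac{\sum_{i'\in\Omega_j^F} M_{i'j}-\theta_j+\varphi_i}{\alpha_{ij}},$$ $$V \ge \max_i \max\left\{ \max_{j\in\Omega_i^B}\frac{Q_j^F-Q_i^B+\sum_{j'\in\Omega_i^B}M_{ij'}-\theta_j+\varphi_i}{\alpha_{ij}},\ \frac{E_i-\varphi_i}{P^{\mathrm s}_{\min}},\ \frac{\eta_{\mathrm c}(\delta_i+\eta_{\mathrm c}C_i-\overline{B}_i)}{P^{\mathrm s}_{\min}+\beta_i-\eta_{\mathrm c}r_i},\ \frac{\frac{1}{\eta_{\mathrm d}}\left(\underline{B}_i+\frac{1}{\eta_{\mathrm d}}D_i-\delta_i\right)}{-P^{\mathrm b}_{\max}+\beta_i+\frac{1}{\eta_{\mathrm d}}r_i}\right\},$$ $$V \le \min_j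 \frac{Q_j^F-A_{j,\max}-\theta_j}{\gamma_j},$$ $$P^{\mathrm b}_{\max}\eta_{\mathrm d}-\beta_i\eta_{\mathrm d} < r_i < \frac{P^{\mathrm s}_{\min}+\beta_i}{\eta_{\mathrm c}}\quad\text{for all } i.$$ Then, when the decisions in every time slot are given by an optimal solution of the per-slot problem P2, the resulting workload queues and battery levels satisfy, for all time slots $t=1,\dots,T$, $$0\le q_j^F(t)\le Q_j^F\ \ \forall j,\qquad 0\le q_i^B(t)\le Q_i^B\ \ \forall i,\qquad \underline{B}_i\le b_i(t)\le\overline{B}_i\ \ \forall i.$$
   Context: System. There are back ends $i\in\mathcal I=\{1,\dots,I\}$ and front ends $j\in\{1,\dots,J\}$; time slots $t=1,\dots,T$. $\Omega_j^F\subseteq\mathcal I$ is the set of back ends linked to front end $j$ and $\Omega_i^B$ is the set of front ends linked to back end $i$ (so $i\in\Omega_j^F \iff j\in\Omega_i^B$). Parameters. $\alpha_{ij}>0$ (bandwidth cost coefficient), $\gamma_j>0$ (disutility per unit of rejected workload), $\beta_i\ge 0$ (battery cost coefficient), $\eta_{\mathrm c},\eta_{\mathrm d}\in(0,1]$ (charging and discharging efficiencies), nonnegative upper bounds $M_{ij},E_i,C_i,D_i,Q_j^F,Q_i^B,\overline U_{ik}$, and battery bounds $\underline B_i\le\overline B_i$. In slot $t$: workload request $A_j(t)\ge 0$, PV generation $z_i(t)\ge0$, electricity buying and selling prices $p_i^{\mathrm b}(t)\ge p_i^{\mathrm s}(t)>0$. Define $A_{j,\max}=\max_{1\le t\le T-1}A_j(t)$,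 $P^{\mathrm b}_{\max}=\max_{i\in\mathcal I,\,1\le t\le T-1}p_i^{\mathrm b}(t)$, $P^{\mathrm s}_{\min}=\min_{i\in\mathcal I,\,1\le t\le T-1}p_i^{\mathrm s}(t)$. Decision variables in slot $t$: accepted workloads $a_j(t)$; transferred workloads $m_{ij}(t)$ for $i\in\Omega_j^F$; processed workloads $e_i(t)$; electricity bought $x_i(t)$ and sold $y_i(t)$; charging $c_i(t)$ and discharging $d_i(t)$; shared energy $u_{ik}(t)$, $i,k\in\mathcal I$. Dynamics ($t=1,\dots,T-1$): $q_j^F(t+1)=q_j^F(t)+a_j(t)-\sum_{i\in\Omega_j^F}m_{ij}(t)$, with $q_j^F(1)=0$; $q_i^B(t+1)=q_i^B(t)+\sum_{j\in\Omega_i^B}m_{ij}(t)-e_i(t)$, with $q_i^B(1)=0$; $b_i(t+1)=b_i(t)+\eta_{\mathrm c}c_i(t)-\frac1{\eta_{\mathrm d}}d_i(t)$, with initial battery level $b_i(1)\in[\underline B_i,\overline B_i]$. Virtual queues, with real parameters $\theta_j,\varphi_i,\delta_i,r_i$ and weight $V$: $h_j^F(t)=q_j^F(t)-\theta_j$, $h_i^B(t)=q_i^B(t)-\varphi_i$, $l_i(t)=b_i(t)-(\delta_i+r_iV)$. Cost in slot $t$: $$f(t)=\sum_i\left[p_i^{\mathrm b}(t)x_i(t)-p_i^{\mathrm s}(t)y_i(t)+\beta_i\left(c_i(t)+d_i(t)\right)\right]+\sum_j\left[\sum_{i\in\Omega_j^F}\alpha_{ij}m_{ij}(t)+\gamma_j\left(A_j(t)-a_j(t)\right)\right].$$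 Drift term: $$g(t)=\sum_j h_j^F(t)\left(a_j(t)-\sum_{i\in\Omega_j^F}m_{ij}(t)\right)+\sum_i h_i^B(t)\left(\sum_{j\in\Omega_i^B}m_{ij}(t)-e_i(t)\right)+\sum_i l_i(t)\left(\eta_{\mathrm c}c_i(t)-\tfrac1{\eta_{\mathrm d}}d_i(t)\right).$$ Problem P2 (online problem, solved in each slot $t=1,\dots,T-1$ given the current $q_j^F(t),q_i^B(t),b_i(t)$ and the current $A_j(t),z_i(t),p_i^{\mathrm b}(t),p_i^{\mathrm s}(t)$; the optimal decisions are then used to update the states through the dynamics): minimize $g(t)+Vf(t)$ over the slot-$t$ decision variables subject to $0\le a_j(t)\le A_j(t)$; $0\le m_{ij}(t)\le M_{ij}$ for $i\in\Omega_j^F$; $0\le e_i(t)\le E_i$; $x_i(t)\ge0$, $y_i(t)\ge0$; $0\le c_i(t)\le C_i$; $0\le d_i(t)\le D_i$; $u_{ik}(t)+u_{ki}(t)=0$ and $-\overline U_{ik}\le u_{ik}(t)\le\overline U_{ik}$ for $k\ne i$; $u_{ii}(t)=0$; power balance $e_i(t)=x_i(t)-y_i(t)+d_i(t)-c_i(t)+z_i(t)+\sum_{k\in\mathcal I\setminus\{i\}}u_{ik}(t)$ for all $i$. The bounds on $q_j^F,q_i^B,b_i$ are not imposed in P2. *)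

theory Defs
  imports Complex_Main "HOL-Library.Extended_Real"
begin

text \<open>
  The finite types \<open>'i\<close> and \<open>'j\<close> index the back ends and the front ends.
  Time slots are the natural numbers \<open>1, \<dots>, horizon\<close>; decisions are taken in the slots
  \<open>{1..<horizon}\<close>.
\<close>

record ('i, 'j) system =
  horizon :: nat
  OmegaF :: "'j \<Rightarrow> 'i set"
  \<alpha> :: "'i \<Rightarrow> 'j \<Rightarrow> real"
  \<gamma> :: "'j \<Rightarrow> real"
  \<beta> :: "'i \<Rightarrow> real"
  eta_c :: real
  eta_d :: real
  Mmax :: "'i \<Rightarrow> 'j \<Rightarrow> real"
  Emax :: "'i \<Rightarrow> real"
  Cmax :: "'i \<Rightarrow> real"
  Dmax :: "'i \<Rightarrow> real"
  QFmax :: "'j \<Rightarrow> real"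
  QBmax :: "'i \<Rightarrow> real"
  Umax :: "'i \<Rightarrow> 'i \<Rightarrow> real"
  Blow :: "'i \<Rightarrow> real"
  Bhigh :: "'i \<Rightarrow> real"
  request :: "'j \<Rightarrow> nat \<Rightarrow> real"      \<comment> \<open>\<open>A\<^sub>j(t)\<close>\<close>
  pv :: "'i \<Rightarrow> nat \<Rightarrow> real"           \<comment> \<open>\<open>z\<^sub>i(t)\<close>\<close>
  price_b :: "'i \<Rightarrow> nat \<Rightarrow> real"
  price_s :: "'i \<Rightarrow> nat \<Rightarrow> real"

record ('i, 'j) control =
  weight :: real                      \<comment> \<open>\<open>V\<close>\<close>
  \<theta> :: "'j \<Rightarrow> real"
  \<phi> :: "'i \<Rightarrow> real"
  \<delta> :: "'i \<Rightarrow> real"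
  slope :: "'i \<Rightarrow> real"               \<comment> \<open>\<open>r\<^sub>i\<close>\<close>

record ('i, 'j) state =
  qF :: "'j \<Rightarrow> real"
  qB :: "'i \<Rightarrow> real"
  bat :: "'i \<Rightarrow> real"

text \<open>
  The decision \<open>transfer X i j\<close> is meaningful only on links; for other pairs it occurs in no
  constraint, cost or dynamics below.
\<close>

record ('i, 'j) decision =
  accept :: "'j \<Rightarrow> real"              \<comment> \<open>\<open>a\<^sub>j\<close>\<close>
  transfer :: "'i \<Rightarrow> 'j \<Rightarrow> real"      \<comment> \<open>\<open>m\<^sub>i\<^sub>j\<close>\<close>
  process :: "'i \<Rightarrow> real"             \<comment> \<open>\<open>e\<^sub>i\<close>\<close>
  buy :: "'i \<Rightarrow> real"                 \<comment> \<open>\<open>x\<^sub>i\<close>\<close>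
  sell :: "'i \<Rightarrow> real"                \<comment> \<open>\<open>y\<^sub>i\<close>\<close>
  charge :: "'i \<Rightarrow> real"              \<comment> \<open>\<open>c\<^sub>i\<close>\<close>
  discharge :: "'i \<Rightarrow> real"           \<comment> \<open>\<open>d\<^sub>i\<close>\<close>
  share :: "'i \<Rightarrow> 'i \<Rightarrow> real"         \<comment> \<open>\<open>u\<^sub>i\<^sub>k\<close>\<close>

definition OmegaB :: "('i::finite, 'j::finite) system \<Rightarrow> 'i \<Rightarrow> 'j set" where
  "OmegaB S i = {j. i \<in> OmegaF S j}"

definition valid_system :: "('i::finite, 'j::finite) system \<Rightarrow> bool" where
  "valid_system S \<longleftrightarrow>
     (\<forall>i j. \<alpha> S i j > 0) \<and> (\<forall>j. \<gamma> S j > 0) \<and> (\<forall>i. \<beta> S i \<ge> 0) \<and>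
     0 < eta_c S \<and> eta_c S \<le> 1 \<and> 0 < eta_d S \<and> eta_d S \<le> 1 \<and>
     (\<forall>i j. Mmax S i j \<ge> 0) \<and>
     (\<forall>i. Emax S i \<ge> 0 \<and> Cmax S i \<ge> 0 \<and> Dmax S i \<ge> 0 \<and> QBmax S i \<ge> 0) \<and>
     (\<forall>j. QFmax S j \<ge> 0) \<and> (\<forall>i k. Umax S i k \<ge> 0) \<and>
     (\<forall>i. Blow S i \<le> Bhigh S i) \<and>
     (\<forall>t\<in>{1..horizon S}.
        (\<forall>j. request S j t \<ge> 0) \<and>
        (\<forall>i. pv S i t \<ge> 0 \<and> price_b S i t \<ge> price_s S i t \<and> price_s S i t > 0))"

text \<open>
  The following extrema are unspecified if \<open>horizon S \<le> 1\<close>, in which case no decision is taken.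
\<close>

definition Amax :: "('i::finite, 'j::finite) system \<Rightarrow> 'j \<Rightarrow> real" where
  "Amax S j = (MAX t\<in>{1..<horizon S}. request S j t)"

definition Pb_max :: "('i::finite, 'j::finite) system \<Rightarrow> real" where
  "Pb_max S = (MAX (i, t)\<in>UNIV \<times> {1..<horizon S}. price_b S i t)"

definition Ps_min :: "('i::finite, 'j::finite) system \<Rightarrow> real" where
  "Ps_min S = (MIN (i, t)\<in>UNIV \<times> {1..<horizon S}. price_s S i t)"

definition hF :: "('i::finite, 'j::finite) control \<Rightarrow> ('i, 'j) state \<Rightarrow> 'j \<Rightarrow> real" where
  "hF K s j = qF s j - \<theta> K j"

definition hB :: "('i::finite, 'j::finite) control \<Rightarrow> ('i, 'j) state \<Rightarrow> 'i \<Rightarrow> real" where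
  "hB K s i = qB s i - \<phi> K i"

definition lbat :: "('i::finite, 'j::finite) control \<Rightarrow> ('i, 'j) state \<Rightarrow> 'i \<Rightarrow> real" where
  "lbat K s i = bat s i - (\<delta> K i + slope K i * weight K)"

definition cost :: "('i::finite, 'j::finite) system \<Rightarrow> nat \<Rightarrow> ('i, 'j) decision \<Rightarrow> real" where
  "cost S t X =
     (\<Sum>i\<in>UNIV. price_b S i t * buy X i - price_s S i t * sell X i
               + \<beta> S i * (charge X i + discharge X i))
   + (\<Sum>j\<in>UNIV. (\<Sum>i\<in>OmegaF S j. \<alpha> S i j * transfer X i j)
               + \<gamma> S j * (request S j t - accept X j))"

definition drift ::
  "('i::finite, 'j::finite) system \<Rightarrow> ('i, 'j) control \<Rightarrow> ('i, 'j) state \<Rightarrow> ('i, 'j) decision \<Rightarrow> real" where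
  "drift S K s X =
     (\<Sum>j\<in>UNIV. hF K s j * (accept X j - (\<Sum>i\<in>OmegaF S j. transfer X i j)))
   + (\<Sum>i\<in>UNIV. hB K s i * ((\<Sum>j\<in>OmegaB S i. transfer X i j) - process X i))
   + (\<Sum>i\<in>UNIV. lbat K s i * (eta_c S * charge X i - 1 / eta_d S * discharge X i))"

definition P2_feasible ::
  "('i::finite, 'j::finite) system \<Rightarrow> nat \<Rightarrow> ('i, 'j) decision \<Rightarrow> bool" where
  "P2_feasible S t X \<longleftrightarrow>
     (\<forall>j. 0 \<le> accept X j \<and> accept X j \<le> request S j t) \<and>
     (\<forall>j. \<forall>i\<in>OmegaF S j. 0 \<le> transfer X i j \<and> transfer X i j \<le> Mmax S i j) \<and>
     (\<forall>i. 0 \<le> process X i \<and> process X i \<le> Emax S i) \<and>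
     (\<forall>i. buy X i \<ge> 0 \<and> sell X i \<ge> 0) \<and>
     (\<forall>i. 0 \<le> charge X i \<and> charge X i \<le> Cmax S i) \<and>
     (\<forall>i. 0 \<le> discharge X i \<and> discharge X i \<le> Dmax S i) \<and>
     (\<forall>i k. k \<noteq> i \<longrightarrow> share X i k + share X k i = 0 \<and>
                        - Umax S i k \<le> share X i k \<and> share X i k \<le> Umax S i k) \<and>
     (\<forall>i. share X i i = 0) \<and>
     (\<forall>i. process X i = buy X i - sell X i + discharge X i - charge X i + pv S i t
                        + (\<Sum>k\<in>UNIV - {i}. share X i k))"

definition P2_objective ::
  "('i::finite, 'j::finite) system \<Rightarrow> ('i, 'j) control \<Rightarrow> nat \<Rightarrow> ('i, 'j) state
     \<Rightarrow> ('i, 'j) decision \<Rightarrow> real" where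
  "P2_objective S K t s X = drift S K s X + weight K * cost S t X"

definition P2_optimal ::
  "('i::finite, 'j::finite) system \<Rightarrow> ('i, 'j) control \<Rightarrow> nat \<Rightarrow> ('i, 'j) state
     \<Rightarrow> ('i, 'j) decision \<Rightarrow> bool" where
  "P2_optimal S K t s X \<longleftrightarrow> is_arg_min (P2_objective S K t s) (P2_feasible S t) X"

definition initial_state :: "('i::finite, 'j::finite) system \<Rightarrow> ('i, 'j) state \<Rightarrow> bool" where
  "initial_state S s \<longleftrightarrow>
     (\<forall>j. qF s j = 0) \<and> (\<forall>i. qB s i = 0) \<and> (\<forall>i. Blow S i \<le> bat s i \<and> bat s i \<le> Bhigh S i)"

definition next_state ::
  "('i::finite, 'j::finite) system \<Rightarrow> ('i, 'j) decision \<Rightarrow> ('i, 'j) state \<Rightarrow> ('i, 'j) state" where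
  "next_state S X s =
     \<lparr> qF = (\<lambda>j. qF s j + accept X j - (\<Sum>i\<in>OmegaF S j. transfer X i j)),
       qB = (\<lambda>i. qB s i + (\<Sum>j\<in>OmegaB S i. transfer X i j) - process X i),
       bat = (\<lambda>i. bat s i + eta_c S * charge X i - 1 / eta_d S * discharge X i) \<rparr>"

definition P2_trajectory ::
  "('i::finite, 'j::finite) system \<Rightarrow> ('i, 'j) control \<Rightarrow> (nat \<Rightarrow> ('i, 'j) state)
     \<Rightarrow> (nat \<Rightarrow> ('i, 'j) decision) \<Rightarrow> bool" where
  "P2_trajectory S K s X \<longleftrightarrow>
     initial_state S (s 1) \<and>
     (\<forall>t\<in>{1..<horizon S}. P2_optimal S K t (s t) (X t) \<and> s (t + 1) = next_state S (X t) (s t))"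

end

theory Submission
  imports Defs
begin

text \<open>
  The objective of the per-slot problem is linear, and apart from the power balance and the
  antisymmetry of the shared energies the constraints only bound single decisions. So an exchange
  argument on one coordinate shows when a decision must vanish: if lowering it to zero keeps
  feasibility and strictly lowers the objective, an optimal decision has it at zero. Where the power
  balance is involved, the freed energy is sold (when processing or charging is stopped), or the
  missing energy is bought (when discharging is stopped). Buying and selling are unbounded, so this
  exchange is always feasible, and its price is controlled by the extreme prices.

  The lower bounds on \<open>V\<close> and its upper bound give these marginal costs the right sign
  in the dangerous zone next to each boundary of the queues and of the battery. There, a decision
  that would push the level further towards that boundary is zero. Outside that zone, the level is
  so far from the boundary that even the largest decision cannot cross it in one slot. Either way
  the bounds pass from one slot to the next. The induction has to treat both kinds of queue
  together: a transfer is unprofitable near an empty front-end queue because the back-end queue is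
  nonnegative, and unprofitable near a full back-end queue because the front-end queue is at most
  its capacity.
\<close>

section \<open>The objective as a separable linear function\<close>

text \<open>
  The decisions are separate arguments because the exchanges below move several of them at a single
  back end at once.
\<close>

definition backend_objective ::
  "('i::finite, 'j::finite) system \<Rightarrow> ('i, 'j) control \<Rightarrow> nat \<Rightarrow> ('i, 'j) state \<Rightarrow> 'i
     \<Rightarrow> real \<Rightarrow> real \<Rightarrow> real \<Rightarrow> real \<Rightarrow> real \<Rightarrow> real" where
  "backend_objective S K t s i e x y c d =
     weight K * price_b S i t * x - weight K * price_s S i t * y
     + (eta_c S * lbat K s i + weight K * \<beta> S i) * c
     + (weight K * \<beta> S i - lbat K s i / eta_d S) * d
     - hB K s i * e"

text \<open>
  Collecting the coefficient of each decision decouples the front ends, the links and the back ends.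
  The workload sent to the back ends is counted per back end in the drift; counting it per front end
  instead merges it with the bandwidth cost of the link.
\<close>

lemma P2_objective_separable:
  "P2_objective S K t s X =
     (\<Sum>j\<in>UNIV. (hF K s j - weight K * \<gamma> S j) * accept X j + weight K * \<gamma> S j * request S j t)
   + (\<Sum>j\<in>UNIV. \<Sum>i\<in>OmegaF S j. (hB K s i - hF K s j + weight K * \<alpha> S i j) * transfer X i j)
   + (\<Sum>i\<in>UNIV. backend_objective S K t s i
                  (process X i) (buy X i) (sell X i) (charge X i) (discharge X i))"
proof -
  have swap: "(\<Sum>i\<in>UNIV. hB K s i * (\<Sum>j\<in>OmegaB S i. transfer X i j))
      = (\<Sum>j\<in>UNIV. \<Sum>i\<in>OmegaF S j. hB K s i * transfer X i j)"
    using sum.swap_restrict[of UNIV UNIV "\<lambda>i j. hB K s i * transfer X i j" "\<lambda>i j. i \<in> OmegaF S j"]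
    by (simp add: OmegaB_def sum_distrib_left)
  show ?thesis
    unfolding P2_objective_def drift_def cost_def backend_objective_def right_diff_distrib
      sum_subtractf swap
    by (simp add: algebra_simps sum.distrib sum_subtractf sum_distrib_left)
qed

lemma sum_UNIV_fun_upd_less:
  fixes F :: "'a::finite \<Rightarrow> 'b \<Rightarrow> real"
  assumes "F k v < F k (f k)"
  shows "(\<Sum>x\<in>UNIV. F x ((f(k := v)) x)) < (\<Sum>x\<in>UNIV. F x (f x))"
  using assms by (intro sum_strict_mono_ex1) auto

section \<open>Decisions that vanish at an optimum\<close>

lemma P2_optimalD:
  assumes "P2_optimal S K t s X"
  shows "P2_feasible S t X"
    and "P2_feasible S t Y \<Longrightarrow> P2_objective S K t s X \<le> P2_objective S K t s Y"
  using assms by (auto simp: P2_optimal_def is_arg_min_def not_less)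

lemma accept_eq_0_if_positive_coefficient:
  assumes opt: "P2_optimal S K t s X"
    and pos: "hF K s j - weight K * \<gamma> S j > 0"
  shows "accept X j = 0"
proof (rule ccontr)
  assume "accept X j \<noteq> 0"
  with P2_optimalD(1)[OF opt] have a: "accept X j > 0" and req: "request S j t \<ge> 0"
    by (auto simp: P2_feasible_def less_le intro: order_trans)
  let ?Y = "X\<lparr>accept := (accept X)(j := 0)\<rparr>"
  have "P2_feasible S t ?Y"
    using P2_optimalD(1)[OF opt] req by (auto simp: P2_feasible_def)
  moreover have "P2_objective S K t s ?Y < P2_objective S K t s X"
    unfolding P2_objective_separable
    using sum_UNIV_fun_upd_less[of "\<lambda>j a. (hF K s j - weight K * \<gamma> S j) * a
            + weight K * \<gamma> S j * request S j t" j 0 "accept X"] a pos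
    by simp
  ultimately show False
    using P2_optimalD(2)[OF opt, of ?Y] by linarith
qed

lemma transfer_eq_0_if_positive_coefficient:
  assumes opt: "P2_optimal S K t s X"
    and link: "i \<in> OmegaF S j"
    and pos: "hB K s i - hF K s j + weight K * \<alpha> S i j > 0"
  shows "transfer X i j = 0"
proof (rule ccontr)
  assume "transfer X i j \<noteq> 0"
  with P2_optimalD(1)[OF opt] link have m: "transfer X i j > 0" and M: "Mmax S i j \<ge> 0"
    by (auto simp: P2_feasible_def less_le intro: order_trans)
  let ?m = "(transfer X)(i := (transfer X i)(j := 0))"
  let ?Y = "X\<lparr>transfer := ?m\<rparr>"
  have "P2_feasible S t ?Y"
    using P2_optimalD(1)[OF opt] M by (auto simp: P2_feasible_def)
  moreover have "P2_objective S K t s ?Y < P2_objective S K t s X"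
  proof -
    define w where "w = (\<lambda>j i. hB K s i - hF K s j + weight K * \<alpha> S i j)"
    have pos': "w j i * transfer X i j > 0"
      using pos m by (simp add: w_def)
    have le: "w l k * ?m k l \<le> w l k * transfer X k l" for k l
      using pos' by (auto intro: less_imp_le)
    have "(\<Sum>i\<in>OmegaF S j. w j i * ?m i j) < (\<Sum>i\<in>OmegaF S j. w j i * transfer X i j)"
      using link pos' le by (intro sum_strict_mono_ex1) auto
    then have "(\<Sum>j\<in>UNIV. \<Sum>i\<in>OmegaF S j. w j i * ?m i j)
        < (\<Sum>j\<in>UNIV. \<Sum>i\<in>OmegaF S j. w j i * transfer X i j)"
      using le by (intro sum_strict_mono_ex1 ballI sum_mono) auto
    then show ?thesis
      unfolding P2_objective_separable w_def by simp
  qed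
  ultimately show False
    using P2_optimalD(2)[OF opt, of ?Y] by linarith
qed

text \<open>
  The decisions of a back end other than the energy sharing may be replaced together as long as its
  net power demand is unchanged: the power balance, the only constraint that ties the back ends
  together, then survives with the same shared energies.
\<close>

lemma backend_optimal:
  assumes opt: "P2_optimal S K t s X"
    and bounds: "0 \<le> e" "e \<le> Emax S i" "0 \<le> x" "0 \<le> y" "0 \<le> c" "c \<le> Cmax S i"
      "0 \<le> d" "d \<le> Dmax S i"
    and balance: "e - x + y - d + c
      = process X i - buy X i + sell X i - discharge X i + charge X i"
  shows "backend_objective S K t s i
           (process X i) (buy X i) (sell X i) (charge X i) (discharge X i)
         \<le> backend_objective S K t s i e x y c d"
proof (rule ccontr)
  assume less: "\<not> ?thesis"
  let ?Y = "X\<lparr>process := (process X)(i := e), buy := (buy X)(i := x), sell := (sell X)(i := y),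
              charge := (charge X)(i := c), discharge := (discharge X)(i := d)\<rparr>"
  have "process X k = buy X k - sell X k + discharge X k - charge X k + pv S k t
      + (\<Sum>l\<in>UNIV - {k}. share X k l)" for k
    using P2_optimalD(1)[OF opt] by (auto simp: P2_feasible_def)
  then have "e = x - y + d - c + pv S i t + (\<Sum>l\<in>UNIV - {i}. share X i l)"
    using balance by (smt (verit))
  then have "P2_feasible S t ?Y"
    using P2_optimalD(1)[OF opt] bounds by (auto simp: P2_feasible_def)
  moreover have "P2_objective S K t s ?Y < P2_objective S K t s X"
  proof -
    have "(\<Sum>k\<in>UNIV. backend_objective S K t s k
             (process ?Y k) (buy ?Y k) (sell ?Y k) (charge ?Y k) (discharge ?Y k))
        < (\<Sum>k\<in>UNIV. backend_objective S K t s k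
             (process X k) (buy X k) (sell X k) (charge X k) (discharge X k))"
      using less by (intro sum_strict_mono_ex1) (auto simp: not_le)
    then show ?thesis
      unfolding P2_objective_separable by simp
  qed
  ultimately show False
    using P2_optimalD(2)[OF opt, of ?Y] by linarith
qed

text \<open>The energy saved by not processing is sold.\<close>

lemma process_eq_0_if_selling_better:
  assumes opt: "P2_optimal S K t s X"
    and better: "hB K s i < weight K * price_s S i t"
  shows "process X i = 0"
proof (rule ccontr)
  assume "process X i \<noteq> 0"
  with P2_optimalD(1)[OF opt] have e: "process X i > 0"
    and feas: "process X i \<le> Emax S i" "0 \<le> buy X i" "0 \<le> sell X i"
      "0 \<le> charge X i" "charge X i \<le> Cmax S i" "0 \<le> discharge X i" "discharge X i \<le> Dmax S i"
    by (auto simp: P2_feasible_def less_le)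
  have "backend_objective S K t s i
           (process X i) (buy X i) (sell X i) (charge X i) (discharge X i)
      \<le> backend_objective S K t s i
           0 (buy X i) (sell X i + process X i) (charge X i) (discharge X i)"
    using e feas by (intro backend_optimal[OF opt]) auto
  then have "(weight K * price_s S i t - hB K s i) * process X i \<le> 0"
    by (simp add: backend_objective_def algebra_simps)
  moreover have "(weight K * price_s S i t - hB K s i) * process X i > 0"
    using better e by simp
  ultimately show False by linarith
qed

text \<open>The energy saved by not charging is sold.\<close>

lemma charge_eq_0_if_selling_better:
  assumes opt: "P2_optimal S K t s X"
    and better: "eta_c S * lbat K s i + weight K * (\<beta> S i + price_s S i t) > 0"
  shows "charge X i = 0"
proof (rule ccontr)
  assume "charge X i \<noteq> 0"
  with P2_optimalD(1)[OF opt] have c: "charge X i > 0"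
    and feas: "0 \<le> process X i" "process X i \<le> Emax S i" "0 \<le> buy X i" "0 \<le> sell X i"
      "charge X i \<le> Cmax S i" "0 \<le> discharge X i" "discharge X i \<le> Dmax S i"
    by (auto simp: P2_feasible_def less_le)
  have "backend_objective S K t s i
           (process X i) (buy X i) (sell X i) (charge X i) (discharge X i)
      \<le> backend_objective S K t s i
           (process X i) (buy X i) (sell X i + charge X i) 0 (discharge X i)"
    using c feas by (intro backend_optimal[OF opt]) auto
  then have "(eta_c S * lbat K s i + weight K * (\<beta> S i + price_s S i t)) * charge X i \<le> 0"
    by (simp add: backend_objective_def algebra_simps)
  moreover have "(eta_c S * lbat K s i + weight K * (\<beta> S i + price_s S i t)) * charge X i > 0"
    using better c by simp
  ultimately show False by linarith
qed

text \<open>The energy that is not discharged is bought instead.\<close>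

lemma discharge_eq_0_if_buying_better:
  assumes opt: "P2_optimal S K t s X"
    and better: "lbat K s i / eta_d S < weight K * (\<beta> S i - price_b S i t)"
  shows "discharge X i = 0"
proof (rule ccontr)
  assume "discharge X i \<noteq> 0"
  with P2_optimalD(1)[OF opt] have d: "discharge X i > 0"
    and feas: "0 \<le> process X i" "process X i \<le> Emax S i" "0 \<le> buy X i" "0 \<le> sell X i"
      "0 \<le> charge X i" "charge X i \<le> Cmax S i" "discharge X i \<le> Dmax S i"
    by (auto simp: P2_feasible_def less_le)
  have "backend_objective S K t s i
           (process X i) (buy X i) (sell X i) (charge X i) (discharge X i)
      \<le> backend_objective S K t s i
           (process X i) (buy X i + discharge X i) (sell X i) (charge X i) 0"
    using d feas by (intro backend_optimal[OF opt]) auto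
  then have "(weight K * (\<beta> S i - price_b S i t) - lbat K s i / eta_d S) * discharge X i \<le> 0"
    by (simp add: backend_objective_def algebra_simps)
  moreover have "(weight K * (\<beta> S i - price_b S i t) - lbat K s i / eta_d S) * discharge X i > 0"
    using better d by simp
  ultimately show False by linarith
qed

section \<open>Preservation of the bounds in one slot\<close>

lemma next_state_simps [simp]:
  "qF (next_state S X s) j = qF s j + accept X j - (\<Sum>i\<in>OmegaF S j. transfer X i j)"
  "qB (next_state S X s) i = qB s i + (\<Sum>j\<in>OmegaB S i. transfer X i j) - process X i"
  "bat (next_state S X s) i = bat s i + eta_c S * charge X i - 1 / eta_d S * discharge X i"
  by (simp_all add: next_state_def)

lemma sum_transfer_bounds:
  assumes "P2_feasible S t X"
  shows "0 \<le> (\<Sum>i\<in>OmegaF S j. transfer X i j)"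
    and "(\<Sum>i\<in>OmegaF S j. transfer X i j) \<le> (\<Sum>i\<in>OmegaF S j. Mmax S i j)"
    and "0 \<le> (\<Sum>j\<in>OmegaB S i. transfer X i j)"
    and "(\<Sum>j\<in>OmegaB S i. transfer X i j) \<le> (\<Sum>j\<in>OmegaB S i. Mmax S i j)"
  using assms by (auto simp: P2_feasible_def OmegaB_def intro!: sum_nonneg sum_mono)

text \<open>
  Above the level \<open>\<theta> + V \<gamma>\<close> rejecting work is cheaper than queueing it. The assumption on
  \<open>V\<close> leaves room for one full request above that level.
\<close>

lemma frontend_queue_le_next:
  assumes opt: "P2_optimal S K t s X"
    and V: "weight K * \<gamma> S j \<le> Q - A - \<theta> K j"
    and A: "request S j t \<le> A"
    and q: "qF s j \<le> Q"
  shows "qF (next_state S X s) j \<le> Q"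
proof -
  note feas = P2_optimalD(1)[OF opt]
  have "accept X j \<le> request S j t"
    using feas by (auto simp: P2_feasible_def)
  then have "qF s j + accept X j \<le> Q"
    using accept_eq_0_if_positive_coefficient[OF opt, of j] V A q by (force simp: hF_def)
  then show ?thesis
    using sum_transfer_bounds(1)[OF feas, of j] by simp
qed

text \<open>
  A queue too short to serve all its links at full rate sends nothing: the bandwidth cost of each link
  exceeds what the difference of the two virtual queues could gain, even with an empty back end.
\<close>

lemma frontend_queue_nonneg_next:
  assumes opt: "P2_optimal S K t s X"
    and V: "\<And>i. i \<in> OmegaF S j \<Longrightarrow>
      (\<Sum>i'\<in>OmegaF S j. Mmax S i' j) - \<theta> K j + \<phi> K i \<le> weight K * \<alpha> S i j"
    and q: "0 \<le> qF s j" "\<And>i. 0 \<le> qB s i"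
  shows "0 \<le> qF (next_state S X s) j"
proof -
  note feas = P2_optimalD(1)[OF opt]
  have a: "0 \<le> accept X j"
    using feas by (auto simp: P2_feasible_def)
  show ?thesis
  proof (cases "(\<Sum>i\<in>OmegaF S j. Mmax S i j) \<le> qF s j")
    case True
    then show ?thesis
      using a sum_transfer_bounds(2)[OF feas, of j] by simp
  next
    case False
    have "transfer X i j = 0" if "i \<in> OmegaF S j" for i
      using transfer_eq_0_if_positive_coefficient[OF opt that] V[OF that] q(2)[of i] False
      by (simp add: hF_def hB_def)
    then show ?thesis
      using a q(1) by simp
  qed
qed

text \<open>
  A back end that could overflow receives nothing: the bandwidth cost of each link exceeds the gain
  even if the front-end queue is at its capacity.
\<close>

lemma backend_queue_le_next:
  assumes opt: "P2_optimal S K t s X"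
    and V: "\<And>j. j \<in> OmegaB S i \<Longrightarrow>
      QF j - Q + (\<Sum>j'\<in>OmegaB S i. Mmax S i j') - \<theta> K j + \<phi> K i \<le> weight K * \<alpha> S i j"
    and q: "qB s i \<le> Q" "\<And>j. qF s j \<le> QF j"
  shows "qB (next_state S X s) i \<le> Q"
proof -
  note feas = P2_optimalD(1)[OF opt]
  have e: "0 \<le> process X i"
    using feas by (auto simp: P2_feasible_def)
  show ?thesis
  proof (cases "qB s i \<le> Q - (\<Sum>j\<in>OmegaB S i. Mmax S i j)")
    case True
    then show ?thesis
      using e sum_transfer_bounds(4)[OF feas, of i] by simp
  next
    case False
    have "transfer X i j = 0" if "j \<in> OmegaB S i" for j
      using transfer_eq_0_if_positive_coefficient[OF opt, of i j] that V[OF that] q(2)[of j] False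
      by (simp add: hF_def hB_def OmegaB_def)
    then show ?thesis
      using e q(1) by simp
  qed
qed

lemma backend_queue_nonneg_next:
  assumes opt: "P2_optimal S K t s X"
    and V: "Emax S i - \<phi> K i \<le> weight K * price_s S i t"
    and q: "0 \<le> qB s i"
  shows "0 \<le> qB (next_state S X s) i"
proof -
  note feas = P2_optimalD(1)[OF opt]
  have "process X i \<le> Emax S i"
    using feas by (auto simp: P2_feasible_def)
  then have "process X i \<le> qB s i"
    using process_eq_0_if_selling_better[OF opt, of i] V q by (force simp: hB_def)
  then show ?thesis
    using sum_transfer_bounds(3)[OF feas, of i] by simp
qed

text \<open>
  The shift \<open>r V\<close> in the virtual battery level enters the marginal cost of charging as
  \<open>- \<eta>\<^sub>c r V\<close>; the assumption on \<open>V\<close> balances it against the revenue from selling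
  the energy and the saved battery cost.
\<close>

lemma battery_le_next:
  assumes opt: "P2_optimal S K t s X"
    and eta: "0 < eta_c S" "0 < eta_d S"
    and V: "eta_c S * (\<delta> K i + eta_c S * Cmax S i - B)
      \<le> weight K * (price_s S i t + \<beta> S i - eta_c S * slope K i)"
    and b: "bat s i \<le> B"
  shows "bat (next_state S X s) i \<le> B"
proof -
  note feas = P2_optimalD(1)[OF opt]
  have "0 \<le> discharge X i" "charge X i \<le> Cmax S i"
    using feas by (auto simp: P2_feasible_def)
  then have d: "0 \<le> 1 / eta_d S * discharge X i"
    and c: "eta_c S * charge X i \<le> eta_c S * Cmax S i"
    using eta by simp_all
  show ?thesis
  proof (cases "bat s i \<le> B - eta_c S * Cmax S i")
    case True
    then show ?thesis
      using c d by simp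
  next
    case False
    then have "0 < eta_c S * (bat s i - (B - eta_c S * Cmax S i))"
      using eta(1) by simp
    also have "\<dots> \<le> eta_c S * lbat K s i + weight K * (\<beta> S i + price_s S i t)"
      using V by (simp add: lbat_def algebra_simps)
    finally have "charge X i = 0"
      by (rule charge_eq_0_if_selling_better[OF opt])
    then show ?thesis
      using b d by simp
  qed
qed

text \<open>
  Here the same shift \<open>r V\<close>, divided by the discharging efficiency, makes stored energy valuable
  enough to outweigh the price of buying energy, less the battery cost that buying avoids.
\<close>

lemma battery_ge_next:
  assumes opt: "P2_optimal S K t s X"
    and eta: "0 < eta_c S" "0 < eta_d S"
    and V: "1 / eta_d S * (B + 1 / eta_d S * Dmax S i - \<delta> K i)
      \<le> weight K * (- price_b S i t + \<beta> S i + 1 / eta_d S * slope K i)"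
    and b: "B \<le> bat s i"
  shows "B \<le> bat (next_state S X s) i"
proof -
  note feas = P2_optimalD(1)[OF opt]
  have "0 \<le> charge X i" "discharge X i \<le> Dmax S i"
    using feas by (auto simp: P2_feasible_def)
  then have c: "0 \<le> eta_c S * charge X i"
    and d: "1 / eta_d S * discharge X i \<le> 1 / eta_d S * Dmax S i"
    using eta by (simp_all add: divide_right_mono)
  show ?thesis
  proof (cases "B + 1 / eta_d S * Dmax S i \<le> bat s i")
    case True
    then show ?thesis
      using c d by simp
  next
    case False
    then have "1 / eta_d S * (bat s i - \<delta> K i) < 1 / eta_d S * (B + 1 / eta_d S * Dmax S i - \<delta> K i)"
      using eta(2) by (intro mult_strict_left_mono) auto
    also note V
    finally have "lbat K s i / eta_d S < weight K * (\<beta> S i - price_b S i t)"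
      by (simp add: lbat_def algebra_simps diff_divide_distrib add_divide_distrib)
    then have "discharge X i = 0"
      by (rule discharge_eq_0_if_buying_better[OF opt])
    then show ?thesis
      using b c by simp
  qed
qed

section \<open>Invariance along a trajectory\<close>

lemma request_le_Amax:
  assumes "t \<in> {1..<horizon S}"
  shows "request S j t \<le> Amax S j"
  unfolding Amax_def using assms by (intro Max_ge) auto

lemma price_b_le_Pb_max:
  assumes "t \<in> {1..<horizon S}"
  shows "price_b S i t \<le> Pb_max S"
  unfolding Pb_max_def using assms by (intro Max_ge) force+

lemma Ps_min_le_price_s:
  assumes "t \<in> {1..<horizon S}"
  shows "Ps_min S \<le> price_s S i t"
  unfolding Ps_min_def using assms by (intro Min_le) force+

lemma Ps_min_pos:
  fixes S :: "('i::finite, 'j::finite) system"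
  assumes "valid_system S" and t: "t \<in> {1..<horizon S}"
  shows "0 < Ps_min S"
proof -
  have "Ps_min S \<in> (\<lambda>(i, t). price_s S i t) ` (UNIV \<times> {1..<horizon S})"
    unfolding Ps_min_def using t by (intro Min_in) auto
  then show ?thesis
    using assms(1) by (auto simp: valid_system_def)
qed

theorem proposition1:
  fixes S :: "('i::finite, 'j::finite) system"
    and K :: "('i, 'j) control"
    and s :: "nat \<Rightarrow> ('i, 'j) state"
    and X :: "nat \<Rightarrow> ('i, 'j) decision"
  assumes system: "valid_system S"
    and A1: "\<forall>j. QFmax S j \<ge> Amax S j + (\<Sum>i\<in>OmegaF S j. Mmax S i j)"
    and A2: "\<forall>i. QBmax S i \<ge> Emax S i + (\<Sum>j\<in>OmegaB S i. Mmax S i j)"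
    and A3: "\<forall>i. Bhigh S i - Blow S i \<ge> eta_c S * Cmax S i + 1 / eta_d S * Dmax S i"
    and A4: "\<forall>i. Pb_max S * eta_c S * eta_d S < Ps_min S + \<beta> S i * (1 + eta_c S * eta_d S)"
    and V_pos: "weight K > 0"
    (* The extended-real supremum over a finite set is its maximum, and is minus infinity
       (no constraint) if an end has no links. *)
    and V_lower1: "ereal (weight K) \<ge>
        (SUP j. SUP i\<in>OmegaF S j.
           ereal (((\<Sum>i'\<in>OmegaF S j. Mmax S i' j) - \<theta> K j + \<phi> K i) / \<alpha> S i j))"
    and V_lower2: "ereal (weight K) \<ge>
        (SUP i. Max
          {SUP j\<in>OmegaB S i.
             ereal ((QFmax S j - QBmax S i + (\<Sum>j'\<in>OmegaB S i. Mmax S i j') - \<theta> K j + \<phi> K i)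
                    / \<alpha> S i j),
           ereal ((Emax S i - \<phi> K i) / Ps_min S),
           ereal (eta_c S * (\<delta> K i + eta_c S * Cmax S i - Bhigh S i)
                  / (Ps_min S + \<beta> S i - eta_c S * slope K i)),
           ereal (1 / eta_d S * (Blow S i + 1 / eta_d S * Dmax S i - \<delta> K i)
                  / (- Pb_max S + \<beta> S i + 1 / eta_d S * slope K i))})"
    and V_upper: "weight K \<le> (MIN j. (QFmax S j - Amax S j - \<theta> K j) / \<gamma> S j)"
    and r_bounds: "\<forall>i. Pb_max S * eta_d S - \<beta> S i * eta_d S < slope K i \<and>
                       slope K i < (Ps_min S + \<beta> S i) / eta_c S"
    and trajectory: "P2_trajectory S K s X"
  shows "\<forall>t\<in>{1..horizon S}.
           (\<forall>j. 0 \<le> qF (s t) j \<and> qF (s t) j \<le> QFmax S j) \<and>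
           (\<forall>i. 0 \<le> qB (s t) i \<and> qB (s t) i \<le> QBmax S i) \<and>
           (\<forall>i. Blow S i \<le> bat (s t) i \<and> bat (s t) i \<le> Bhigh S i)"
proof -
  let ?V = "weight K"
  have par: "\<alpha> S i j > 0" "\<gamma> S j > 0" "0 < eta_c S" "0 < eta_d S" for i j
    using system by (auto simp: valid_system_def)

  have V_frontend_empty:
    "(\<Sum>i'\<in>OmegaF S j. Mmax S i' j) - \<theta> K j + \<phi> K i \<le> ?V * \<alpha> S i j" if "i \<in> OmegaF S j" for i j
  proof -
    have "ereal (((\<Sum>i'\<in>OmegaF S j. Mmax S i' j) - \<theta> K j + \<phi> K i) / \<alpha> S i j) \<le> ereal ?V"
      using V_lower1 that by (auto simp: SUP_le_iff)
    then show ?thesis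
      using par(1)[of i j] by (simp add: pos_divide_le_eq)
  qed

  have V_backend:
    "(SUP j\<in>OmegaB S i.
        ereal ((QFmax S j - QBmax S i + (\<Sum>j'\<in>OmegaB S i. Mmax S i j') - \<theta> K j + \<phi> K i)
               / \<alpha> S i j)) \<le> ereal ?V"
    "(Emax S i - \<phi> K i) / Ps_min S \<le> ?V"
    "eta_c S * (\<delta> K i + eta_c S * Cmax S i - Bhigh S i)
       / (Ps_min S + \<beta> S i - eta_c S * slope K i) \<le> ?V"
    "1 / eta_d S * (Blow S i + 1 / eta_d S * Dmax S i - \<delta> K i)
       / (- Pb_max S + \<beta> S i + 1 / eta_d S * slope K i) \<le> ?V" for i
    using V_lower2 by (auto simp: SUP_le_iff)

  have V_backend_full:
    "QFmax S j - QBmax S i + (\<Sum>j'\<in>OmegaB S i. Mmax S i j') - \<theta> K j + \<phi> K i \<le> ?V * \<alpha> S i j"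
    if "j \<in> OmegaB S i" for i j
  proof -
    have "ereal ((QFmax S j - QBmax S i + (\<Sum>j'\<in>OmegaB S i. Mmax S i j') - \<theta> K j + \<phi> K i)
        / \<alpha> S i j) \<le> ereal ?V"
      using V_backend(1)[of i] that by (auto simp: SUP_le_iff)
    then show ?thesis
      using par(1)[of i j] by (simp add: pos_divide_le_eq)
  qed

  have V_frontend_full: "?V * \<gamma> S j \<le> QFmax S j - Amax S j - \<theta> K j" for j
  proof -
    have "?V \<le> (QFmax S j - Amax S j - \<theta> K j) / \<gamma> S j"
      using V_upper by (rule order_trans) (auto intro: Min_le)
    then show ?thesis
      using par(2)[of j] by (simp add: pos_le_divide_eq)
  qed

  (* In a slot where decisions are taken, the extreme prices may be replaced by the current ones. The
     bounds on the slope make the denominators of the battery conditions positive. *)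
  have V_backend_empty: "Emax S i - \<phi> K i \<le> ?V * price_s S i t"
    if t: "t \<in> {1..<horizon S}" for i t
  proof -
    have "Emax S i - \<phi> K i \<le> ?V * Ps_min S"
      using V_backend(2)[of i] Ps_min_pos[OF system t] by (simp add: pos_divide_le_eq)
    also have "\<dots> \<le> ?V * price_s S i t"
      using V_pos Ps_min_le_price_s[OF t] by simp
    finally show ?thesis .
  qed
  have V_battery_full: "eta_c S * (\<delta> K i + eta_c S * Cmax S i - Bhigh S i)
      \<le> ?V * (price_s S i t + \<beta> S i - eta_c S * slope K i)"
    if t: "t \<in> {1..<horizon S}" for i t
  proof -
    have "slope K i < (Ps_min S + \<beta> S i) / eta_c S"
      using r_bounds by simp
    then have "0 < Ps_min S + \<beta> S i - eta_c S * slope K i"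
      using par(3) by (simp add: pos_less_divide_eq mult.commute)
    then have "eta_c S * (\<delta> K i + eta_c S * Cmax S i - Bhigh S i)
        \<le> ?V * (Ps_min S + \<beta> S i - eta_c S * slope K i)"
      using V_backend(3)[of i] by (simp add: pos_divide_le_eq)
    also have "\<dots> \<le> ?V * (price_s S i t + \<beta> S i - eta_c S * slope K i)"
      using V_pos Ps_min_le_price_s[OF t] by simp
    finally show ?thesis .
  qed
  have V_battery_empty: "1 / eta_d S * (Blow S i + 1 / eta_d S * Dmax S i - \<delta> K i)
      \<le> ?V * (- price_b S i t + \<beta> S i + 1 / eta_d S * slope K i)"
    if t: "t \<in> {1..<horizon S}" for i t
  proof -
    have "(Pb_max S - \<beta> S i) * eta_d S < slope K i"
      using r_bounds by (simp add: algebra_simps)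
    then have "Pb_max S - \<beta> S i < slope K i / eta_d S"
      using par(4) by (simp only: pos_less_divide_eq)
    then have "0 < - Pb_max S + \<beta> S i + 1 / eta_d S * slope K i"
      by simp
    then have "1 / eta_d S * (Blow S i + 1 / eta_d S * Dmax S i - \<delta> K i)
        \<le> ?V * (- Pb_max S + \<beta> S i + 1 / eta_d S * slope K i)"
      using V_backend(4)[of i] by (simp only: pos_divide_le_eq)
    also have "\<dots> \<le> ?V * (- price_b S i t + \<beta> S i + 1 / eta_d S * slope K i)"
      using V_pos price_b_le_Pb_max[OF t] by simp
    finally show ?thesis .
  qed

  define inbounds where "inbounds \<sigma> \<longleftrightarrow>
    (\<forall>j. 0 \<le> qF \<sigma> j \<and> qF \<sigma> j \<le> QFmax S j) \<and>
    (\<forall>i. 0 \<le> qB \<sigma> i \<and> qB \<sigma> i \<le> QBmax S i) \<and>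
    (\<forall>i. Blow S i \<le> bat \<sigma> i \<and> bat \<sigma> i \<le> Bhigh S i)" for \<sigma> :: "('i, 'j) state"
  have init: "inbounds (s 1)"
    using trajectory system
    by (auto simp: inbounds_def P2_trajectory_def initial_state_def valid_system_def)
  have inbounds_step: "inbounds (s (t + 1))" if t: "t \<in> {1..<horizon S}" and IH: "inbounds (s t)" for t
  proof -
    have opt: "P2_optimal S K t (s t) (X t)" and next_eq: "s (t + 1) = next_state S (X t) (s t)"
      using trajectory t by (auto simp: P2_trajectory_def)
    have bounds: "0 \<le> qF (s t) j" "qF (s t) j \<le> QFmax S j" "0 \<le> qB (s t) i"
      "qB (s t) i \<le> QBmax S i" "Blow S i \<le> bat (s t) i" "bat (s t) i \<le> Bhigh S i" for i j
      using IH by (auto simp: inbounds_def)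
    show ?thesis
      unfolding inbounds_def next_eq
      by (intro allI conjI
          frontend_queue_nonneg_next[OF opt V_frontend_empty bounds(1) bounds(3)]
          frontend_queue_le_next[OF opt V_frontend_full request_le_Amax[OF t] bounds(2)]
          backend_queue_nonneg_next[OF opt V_backend_empty[OF t] bounds(3)]
          backend_queue_le_next[OF opt V_backend_full bounds(4) bounds(2)]
          battery_ge_next[OF opt par(3,4) V_battery_empty[OF t] bounds(5)]
          battery_le_next[OF opt par(3,4) V_battery_full[OF t] bounds(6)])
  qed
  have "inbounds (s t)" if "1 \<le> t" "t \<le> horizon S" for t
    using that
  proof (induction t rule: dec_induct)
    case base
    show ?case by (rule init)
  next
    case (step t)
    then show ?case
      using inbounds_step[of t] by simp
  qed
  then show ?thesis
    by (simp add: inbounds_def)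
qed

end
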